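(* Let $(X,\alpha)$ be a $\mathbb Z_2$-space and assume that $X$ admits an equivariant mean. Then: (1) If $X$ is an AE, then $(X,\alpha)$ is a $\mathbb Z_2$-AE. (2) If $X$ is an AR, then $(X,\alpha)$ is a $\mathbb Z_2$-AR.
   Context: All spaces are Hausdorff and "map" means continuous function. An involution on a space $X$ is a continuous map $\alpha:X\to X$ with $\alpha\circ\alpha=1_X$. Actions of $\mathbb Z_2=\{-1,1\}$ on $X$ correspond to involutions via $\alpha(x)=-1\cdot x$; $(X,\alpha)$ denotes the corresponding $\mathbb Z_2$-space. A subset $A$ is invariant if $\alpha(A)=A$; a function $f:(X,\alpha)\to(Y,\beta)$ is equivariant if $f\circ\alpha=\beta\circ f$. A mean (2-mean) on $X$ is a continuous map $p:X\times X\to X$ with $p(x,x)=x$ and $p(x,y)=p(y,x)$ for all $x,y\in X$. On $(X,\alpha)$ it is equivariant if $p(\alpha(x),\alpha(y))=\alpha(p(x,y))$ for all $x,y$. A $\mathbb Z_2$-space $Y$ is a $\mathbb Z_2$-AE if for every metrizable $\mathbb Z_2$-space $Z$, every closed invariant $A\subseteq Z$ and every continuous equivariant $f:A\to Y$ there is a continuous equivariant $F:Z\to Y$ with $F|_A=f$. A metrizable $\mathbb Z_2$-space $Y$ is a $\mathbb Z_2$-AR if for every metrizable $\mathbb Z_2$-space $Z$ containing $Y$ as a closed invariant subset there is a continuous equivariant retraction $Z\to Y$. AE and AR are the same notions without group action (trivial group); in particular an AR is metrizable. *)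

theory Defs
  imports "HOL-Analysis.Analysis"
begin

definition involution_on :: "'a topology \<Rightarrow> ('a \<Rightarrow> 'a) \<Rightarrow> bool" where
  "involution_on X \<alpha> \<longleftrightarrow> continuous_map X X \<alpha> \<and> (\<forall>x\<in>topspace X. \<alpha> (\<alpha> x) = x)"

text \<open>A \<open>\<int>\<^sub>2\<close>-space is given by its topology and the involution through which \<open>-1\<close> acts.\<close>

definition Z2_space :: "'a topology \<Rightarrow> ('a \<Rightarrow> 'a) \<Rightarrow> bool" where
  "Z2_space X \<alpha> \<longleftrightarrow> Hausdorff_space X \<and> involution_on X \<alpha>"

definition invariant_set :: "('a \<Rightarrow> 'a) \<Rightarrow> 'a set \<Rightarrow> bool" where
  "invariant_set \<alpha> A \<longleftrightarrow> \<alpha> ` A = A"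

definition equivariant_on :: "'a set \<Rightarrow> ('a \<Rightarrow> 'a) \<Rightarrow> ('b \<Rightarrow> 'b) \<Rightarrow> ('a \<Rightarrow> 'b) \<Rightarrow> bool" where
  "equivariant_on A \<alpha> \<beta> f \<longleftrightarrow> (\<forall>x\<in>A. f (\<alpha> x) = \<beta> (f x))"

definition mean_on :: "'a topology \<Rightarrow> ('a \<times> 'a \<Rightarrow> 'a) \<Rightarrow> bool" where
  "mean_on X p \<longleftrightarrow>
     continuous_map (prod_topology X X) X p \<and>
     (\<forall>x\<in>topspace X. p (x, x) = x) \<and>
     (\<forall>x\<in>topspace X. \<forall>y\<in>topspace X. p (x, y) = p (y, x))"

definition equivariant_mean_on :: "'a topology \<Rightarrow> ('a \<Rightarrow> 'a) \<Rightarrow> ('a \<times> 'a \<Rightarrow> 'a) \<Rightarrow> bool" where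
  "equivariant_mean_on X \<alpha> p \<longleftrightarrow>
     mean_on X p \<and>
     (\<forall>x\<in>topspace X. \<forall>y\<in>topspace X. p (\<alpha> x, \<alpha> y) = \<alpha> (p (x, y)))"

text \<open>
  A definition in HOL cannot quantify over types, so the four notions below take the type \<open>'z\<close>
  of the points of the test spaces \<open>Z\<close> as a parameter. The unrestricted notions
  (\<open>Z\<close> any metrizable space) are the conjunctions of these over all types \<open>'z\<close>, so that
  an implication between them follows from its instances at a common, arbitrary \<open>'z\<close>.
\<close>

definition absolute_extensor :: "'z itself \<Rightarrow> 'a topology \<Rightarrow> bool" where
  "absolute_extensor T Y \<longleftrightarrow>
     Hausdorff_space Y \<and>
     (\<forall>(Z :: 'z topology) A f.
        metrizable_space Z \<and> closedin Z A \<and> continuous_map (subtopology Z A) Y f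
        \<longrightarrow> (\<exists>F. continuous_map Z Y F \<and> (\<forall>x\<in>A. F x = f x)))"

definition Z2_absolute_extensor :: "'z itself \<Rightarrow> 'a topology \<Rightarrow> ('a \<Rightarrow> 'a) \<Rightarrow> bool" where
  "Z2_absolute_extensor T Y \<beta> \<longleftrightarrow>
     Z2_space Y \<beta> \<and>
     (\<forall>(Z :: 'z topology) \<gamma> A f.
        metrizable_space Z \<and> Z2_space Z \<gamma> \<and> closedin Z A \<and> invariant_set \<gamma> A \<and>
        continuous_map (subtopology Z A) Y f \<and> equivariant_on A \<gamma> \<beta> f
        \<longrightarrow> (\<exists>F. continuous_map Z Y F \<and> equivariant_on (topspace Z) \<gamma> \<beta> F \<and>
                 (\<forall>x\<in>A. F x = f x)))"

text \<open>
  \<open>Y\<close> and \<open>Z\<close> may have different point types, so ``\<open>Z\<close> contains \<open>Y\<close> as a closed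
  (invariant) subset'' is expressed by an (equivariant) embedding \<open>e\<close> of \<open>Y\<close> in \<open>Z\<close>
  with closed (invariant) image, which is then the set that \<open>Z\<close> is to be retracted onto.
\<close>

definition absolute_retract :: "'z itself \<Rightarrow> 'a topology \<Rightarrow> bool" where
  "absolute_retract T Y \<longleftrightarrow>
     metrizable_space Y \<and>
     (\<forall>(Z :: 'z topology) e.
        metrizable_space Z \<and> embedding_map Y Z e \<and> closedin Z (e ` topspace Y)
        \<longrightarrow> (e ` topspace Y) retract_of_space Z)"

definition Z2_retract_of_space :: "'z set \<Rightarrow> 'z topology \<Rightarrow> ('z \<Rightarrow> 'z) \<Rightarrow> bool" where
  "Z2_retract_of_space B Z \<gamma> \<longleftrightarrow>
     B \<subseteq> topspace Z \<and>
     (\<exists>r. continuous_map Z (subtopology Z B) r \<and> equivariant_on (topspace Z) \<gamma> \<gamma> r \<and>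
          (\<forall>x\<in>B. r x = x))"

definition Z2_absolute_retract :: "'z itself \<Rightarrow> 'a topology \<Rightarrow> ('a \<Rightarrow> 'a) \<Rightarrow> bool" where
  "Z2_absolute_retract T Y \<beta> \<longleftrightarrow>
     Z2_space Y \<beta> \<and> metrizable_space Y \<and>
     (\<forall>(Z :: 'z topology) \<gamma> e.
        metrizable_space Z \<and> Z2_space Z \<gamma> \<and>
        embedding_map Y Z e \<and> equivariant_on (topspace Y) \<beta> \<gamma> e \<and>
        closedin Z (e ` topspace Y) \<and> invariant_set \<gamma> (e ` topspace Y)
        \<longrightarrow> Z2_retract_of_space (e ` topspace Y) Z \<gamma>)"

end

theory Submission
  imports Defs
begin

text \<open>
  Any map \<open>F\<close> from a \<open>\<int>\<^sub>2\<close>-space \<open>Z\<close> to \<open>X\<close> has a conjugate \<open>\<alpha> \<circ> F \<circ> \<gamma>\<close>, and conjugating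
  twice gives \<open>F\<close> back. The mean of \<open>F\<close> and its conjugate is therefore equivariant: conjugation
  only swaps the two entries of a symmetric mean that commutes with \<open>\<alpha>\<close>. Where \<open>F\<close> is
  already equivariant it agrees with its conjugate, and idempotence of the mean leaves it
  unchanged there (lemma \<open>symmetrization\<close>). So a non-equivariant extension, provided by the AE
  property, can be averaged into an equivariant extension of the same map. The AR case is the
  same argument for a retraction \<open>Z \<rightarrow> e(X)\<close>, read as an extension over \<open>Z\<close> of the inverse
  \<open>e(X) \<rightarrow> X\<close> of the embedding.
\<close>

lemma Z2_spaceD:
  assumes "Z2_space X \<alpha>"
  shows "continuous_map X X \<alpha>"
    and "x \<in> topspace X \<Longrightarrow> \<alpha> x \<in> topspace X"
    and "x \<in> topspace X \<Longrightarrow> \<alpha> (\<alpha> x) = x"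
proof -
  show "continuous_map X X \<alpha>"
    using assms by (simp add: Z2_space_def involution_on_def)
  then show "x \<in> topspace X \<Longrightarrow> \<alpha> x \<in> topspace X"
    by (blast dest: continuous_map_image_subset_topspace)
  show "x \<in> topspace X \<Longrightarrow> \<alpha> (\<alpha> x) = x"
    using assms by (simp add: Z2_space_def involution_on_def)
qed

text \<open>
  Averaging \<open>F\<close> with its conjugate \<open>\<alpha> \<circ> F \<circ> \<gamma>\<close> imposes equivariance everywhere without
  disturbing the values on a set where \<open>F\<close> is equivariant already.
\<close>

lemma symmetrization:
  assumes X: "Z2_space X \<alpha>" and Z: "Z2_space Z \<gamma>"
    and p: "equivariant_mean_on X \<alpha> p"
    and F: "continuous_map Z X F"
    and A: "A \<subseteq> topspace Z" "equivariant_on A \<gamma> \<alpha> F"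
  obtains G where "continuous_map Z X G" "equivariant_on (topspace Z) \<gamma> \<alpha> G"
    "\<And>z. z \<in> A \<Longrightarrow> G z = F z"
proof
  define G where "G z = p (F z, \<alpha> (F (\<gamma> z)))" for z
  note alpha = Z2_spaceD[OF X]
  note gamma = Z2_spaceD[OF Z]
  have F_in: "F z \<in> topspace X" if "z \<in> topspace Z" for z
    using continuous_map_image_subset_topspace[OF F] that by blast
  have p_cont: "continuous_map (prod_topology X X) X p"
    and p_idem: "\<And>x. x \<in> topspace X \<Longrightarrow> p (x, x) = x"
    and p_sym: "\<And>x y. \<lbrakk>x \<in> topspace X; y \<in> topspace X\<rbrakk> \<Longrightarrow> p (x, y) = p (y, x)"
    and p_equiv: "\<And>x y. \<lbrakk>x \<in> topspace X; y \<in> topspace X\<rbrakk>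
                    \<Longrightarrow> p (\<alpha> x, \<alpha> y) = \<alpha> (p (x, y))"
    using p by (auto simp: equivariant_mean_on_def mean_on_def)
  have "continuous_map Z X (\<alpha> \<circ> (F \<circ> \<gamma>))"
    by (intro continuous_map_compose[of Z X _ X] continuous_map_compose[of Z Z] alpha(1) gamma(1) F)
  then have "continuous_map Z (prod_topology X X) (\<lambda>z. (F z, \<alpha> (F (\<gamma> z))))"
    using F by (simp add: continuous_map_pairwise o_def)
  from continuous_map_compose[OF this p_cont] show "continuous_map Z X G"
    by (simp add: o_def G_def[abs_def])
  show "equivariant_on (topspace Z) \<gamma> \<alpha> G"
    unfolding equivariant_on_def
  proof
    fix z assume z: "z \<in> topspace Z"
    note in_X = F_in[OF z] F_in[OF gamma(2)[OF z]]
    have "G (\<gamma> z) = p (F (\<gamma> z), \<alpha> (F z))"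
      by (simp add: G_def gamma(3)[OF z])
    also have "\<dots> = p (\<alpha> (F z), F (\<gamma> z))"
      by (rule p_sym[OF in_X(2) alpha(2)[OF in_X(1)]])
    also have "\<dots> = p (\<alpha> (F z), \<alpha> (\<alpha> (F (\<gamma> z))))"
      by (simp add: alpha(3) in_X)
    also have "\<dots> = \<alpha> (G z)"
      unfolding G_def by (rule p_equiv[OF in_X(1) alpha(2)[OF in_X(2)]])
    finally show "G (\<gamma> z) = \<alpha> (G z)" .
  qed
  show "G z = F z" if "z \<in> A" for z
  proof -
    have "F (\<gamma> z) = \<alpha> (F z)" and "F z \<in> topspace X"
      using A that F_in by (auto simp: equivariant_on_def)
    then show ?thesis
      by (simp add: G_def alpha(3) p_idem)
  qed
qed

theorem Z2_absolute_extensor_if_equivariant_mean: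
  fixes X :: "'a topology"
  assumes X: "Z2_space X \<alpha>" and p: "equivariant_mean_on X \<alpha> p"
    and AE: "absolute_extensor TYPE('z) X"
  shows "Z2_absolute_extensor TYPE('z) X \<alpha>"
  unfolding Z2_absolute_extensor_def
proof (intro conjI allI impI X)
  fix Z :: "'z topology" and \<gamma> A f
  assume "metrizable_space Z \<and> Z2_space Z \<gamma> \<and> closedin Z A \<and> invariant_set \<gamma> A \<and>
    continuous_map (subtopology Z A) X f \<and> equivariant_on A \<gamma> \<alpha> f"
  then have Z: "metrizable_space Z" "Z2_space Z \<gamma>" and A: "closedin Z A" "invariant_set \<gamma> A"
    and f: "continuous_map (subtopology Z A) X f" "equivariant_on A \<gamma> \<alpha> f"
    by auto
  obtain F where F: "continuous_map Z X F" "\<And>z. z \<in> A \<Longrightarrow> F z = f z"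
    using AE[unfolded absolute_extensor_def, THEN conjunct2, rule_format, of Z A f] Z(1) A(1) f(1)
    by auto
  \<comment> \<open>Invariance of \<open>A\<close> makes \<open>F\<close> agree with \<open>f\<close> at \<open>\<gamma> z\<close> as well as at \<open>z\<close>.\<close>
  have "equivariant_on A \<gamma> \<alpha> F"
    unfolding equivariant_on_def
  proof
    fix z assume z: "z \<in> A"
    with A(2) have "\<gamma> z \<in> A"
      by (auto simp: invariant_set_def)
    with z f(2) show "F (\<gamma> z) = \<alpha> (F z)"
      by (simp add: F(2) equivariant_on_def)
  qed
  then obtain G where "continuous_map Z X G" "equivariant_on (topspace Z) \<gamma> \<alpha> G"
    "\<And>z. z \<in> A \<Longrightarrow> G z = F z"
    by (rule symmetrization[OF X Z(2) p F(1) closedin_subset[OF A(1)]]) blast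
  then show "\<exists>F. continuous_map Z X F \<and> equivariant_on (topspace Z) \<gamma> \<alpha> F \<and> (\<forall>x\<in>A. F x = f x)"
    using F(2) by auto
qed

text \<open>
  The mean lives on \<open>X\<close> and not on \<open>e(X)\<close>, so the retraction \<open>r\<close> onto \<open>e(X)\<close> is moved to \<open>X\<close>
  by the inverse \<open>h\<close> of \<open>e\<close>, averaged there, and moved back. On \<open>e(X)\<close> the map
  \<open>h \<circ> r\<close> is \<open>h\<close>, which is equivariant as the inverse of an equivariant map; averaging thus
  keeps the points of \<open>e(X)\<close> fixed.
\<close>

theorem Z2_absolute_retract_if_equivariant_mean:
  fixes X :: "'a topology"
  assumes X: "Z2_space X \<alpha>" and p: "equivariant_mean_on X \<alpha> p"
    and AR: "absolute_retract TYPE('z) X"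
  shows "Z2_absolute_retract TYPE('z) X \<alpha>"
  unfolding Z2_absolute_retract_def
proof (intro conjI allI impI X)
  show "metrizable_space X"
    using AR by (simp add: absolute_retract_def)
next
  fix Z :: "'z topology" and \<gamma> and e :: "'a \<Rightarrow> 'z"
  let ?B = "e ` topspace X"
  assume "metrizable_space Z \<and> Z2_space Z \<gamma> \<and> embedding_map X Z e \<and>
    equivariant_on (topspace X) \<alpha> \<gamma> e \<and> closedin Z ?B \<and> invariant_set \<gamma> ?B"
  then have Z: "metrizable_space Z" "Z2_space Z \<gamma>"
    and e: "embedding_map X Z e" "equivariant_on (topspace X) \<alpha> \<gamma> e" and B: "closedin Z ?B"
    by auto
  have B_sub: "?B \<subseteq> topspace Z"
    using B by (rule closedin_subset)
  obtain r where r: "continuous_map Z (subtopology Z ?B) r" "\<And>y. y \<in> ?B \<Longrightarrow> r y = y"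
    using AR[unfolded absolute_retract_def, THEN conjunct2, rule_format, of Z e] Z(1) e(1) B
    by (auto simp: retract_of_space_def)
  have "homeomorphic_map X (subtopology Z ?B) e"
    using e(1) by (simp add: embedding_map_def)
  then obtain h where "homeomorphic_maps X (subtopology Z ?B) e h"
    using homeomorphic_map_maps by blast
  then have e_cont: "continuous_map X (subtopology Z ?B) e"
    and h: "continuous_map (subtopology Z ?B) X h" "\<And>x. x \<in> topspace X \<Longrightarrow> h (e x) = x"
    by (auto simp: homeomorphic_maps_def)
  have hr: "continuous_map Z X (h \<circ> r)"
    using r(1) h(1) by (rule continuous_map_compose)
  have hr_e: "(h \<circ> r) (e x) = x" if "x \<in> topspace X" for x
    using that h(2) r(2) by simp
  have "equivariant_on ?B \<gamma> \<alpha> (h \<circ> r)"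
    unfolding equivariant_on_def
  proof
    fix y assume "y \<in> ?B"
    then obtain x where x: "x \<in> topspace X" "y = e x"
      by blast
    have "\<gamma> y = e (\<alpha> x)"
      using x e(2) by (simp add: equivariant_on_def)
    then have "(h \<circ> r) (\<gamma> y) = \<alpha> x"
      using hr_e Z2_spaceD(2)[OF X x(1)] by simp
    then show "(h \<circ> r) (\<gamma> y) = \<alpha> ((h \<circ> r) y)"
      using hr_e[OF x(1)] x(2) by simp
  qed
  then obtain G where G: "continuous_map Z X G" "equivariant_on (topspace Z) \<gamma> \<alpha> G"
    "\<And>y. y \<in> ?B \<Longrightarrow> G y = (h \<circ> r) y"
    by (rule symmetrization[OF X Z(2) p hr B_sub]) blast
  have "continuous_map Z (subtopology Z ?B) (e \<circ> G)"
    using G(1) e_cont by (rule continuous_map_compose)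
  moreover have "equivariant_on (topspace Z) \<gamma> \<gamma> (e \<circ> G)"
    unfolding equivariant_on_def
  proof
    fix z assume z: "z \<in> topspace Z"
    then have "G z \<in> topspace X"
      using continuous_map_image_subset_topspace[OF G(1)] by blast
    then show "(e \<circ> G) (\<gamma> z) = \<gamma> ((e \<circ> G) z)"
      using z G(2) e(2) by (simp add: equivariant_on_def)
  qed
  moreover have "(e \<circ> G) y = y" if "y \<in> ?B" for y
    using that G(3) hr_e by auto
  ultimately show "Z2_retract_of_space ?B Z \<gamma>"
    using B_sub unfolding Z2_retract_of_space_def by blast
qed

theorem corollary3p3p1:
  fixes X :: "'a topology" and \<alpha> :: "'a \<Rightarrow> 'a"
  assumes "Z2_space X \<alpha>"
    and "\<exists>p. equivariant_mean_on X \<alpha> p"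
  shows "(absolute_extensor TYPE('z) X \<longrightarrow> Z2_absolute_extensor TYPE('z) X \<alpha>) \<and>
         (absolute_retract TYPE('z) X \<longrightarrow> Z2_absolute_retract TYPE('z) X \<alpha>)"
  using assms Z2_absolute_extensor_if_equivariant_mean Z2_absolute_retract_if_equivariant_mean
  by blast

end
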